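(* If $G$ is a graph on $n$ vertices with Randić matrix $R$, then $$RE(G)\leq \sqrt{(n-1-\operatorname{null}(R))(\operatorname{tr}(R^2)-1)}+1.$$ Furthermore, if $G$ is bipartite, then $$RE(G)\leq \sqrt{(n-2-\operatorname{null}(R))(\operatorname{tr}(R^2)-2)}+2.$$
   Context: Graphs are finite, simple and undirected. For a graph $G$ with vertex set $V$, edge set $E$ and vertex degrees $d_u$, the Randić matrix $R=[r_{uv}]$ is the real symmetric matrix indexed by $V$ with $r_{uv}=1/\sqrt{d_ud_v}$ if $uv\in E$ and $r_{uv}=0$ otherwise. The Randić energy is $RE(G)=\sum_{i=1}^n|\lambda_i|$, where $\lambda_1,\dots,\lambda_n$ are the eigenvalues of $R$ with multiplicity. $\operatorname{null}(R)$ denotes the dimension of the null space of $R$. *)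

theory Defs
  imports "HOL-Analysis.Analysis" "HOL-Computational_Algebra.Polynomial"
begin

(* A finite simple undirected graph has the finite type 'v as its vertex set, so that
   n = CARD('v), and is given by its edge set E, a set of two-element subsets of 'v. *)
definition simple_graph :: "'v::finite set set \<Rightarrow> bool" where
  "simple_graph E \<longleftrightarrow> (\<forall>e\<in>E. card e = 2)"

definition bipartite :: "'v::finite set set \<Rightarrow> bool" where
  "bipartite E \<longleftrightarrow>
     (\<exists>X Y. X \<union> Y = UNIV \<and> X \<inter> Y = {} \<and> (\<forall>e\<in>E. \<exists>x\<in>X. \<exists>y\<in>Y. e = {x, y}))"

definition degree_of :: "'v::finite set set \<Rightarrow> 'v \<Rightarrow> nat" where
  "degree_of E u = card {v. {u, v} \<in> E}"

definition randic_matrix :: "'v::finite set set \<Rightarrow> real^'v^'v" where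
  "randic_matrix E =
     (\<chi> u v. if {u, v} \<in> E then 1 / sqrt (real (degree_of E u) * real (degree_of E v)) else 0)"

definition charpoly :: "'a::comm_ring_1^'n::finite^'n \<Rightarrow> 'a poly" where
  "charpoly A = det (\<chi> i j. (if i = j then [:0, 1:] else 0) - [:A $ i $ j:])"

(* Only real eigenvalues are collected (with algebraic multiplicity). For a symmetric matrix, the
   only case used here, the characteristic polynomial splits over the reals, so these are all n
   eigenvalues. *)
definition eigenvalues_mset :: "real^'n::finite^'n \<Rightarrow> real multiset" where
  "eigenvalues_mset A = proots (charpoly A)"

definition randic_energy :: "'v::finite set set \<Rightarrow> real" where
  "randic_energy E = (\<Sum>x\<in>#eigenvalues_mset (randic_matrix E). \<bar>x\<bar>)"

definition nullity :: "real^'n::finite^'m::finite \<Rightarrow> nat" where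
  "nullity A = dim {x. A *v x = 0}"

end

theory Submission
  imports Defs
begin

text \<open>
  The Randic matrix is symmetric, so it has an orthonormal eigenbasis with eigenvalues
  \<open>d i\<close>. In terms of these the energy is \<open>\<Sum>\<bar>d i\<bar>\<close>, the trace of the square is \<open>\<Sum>(d i)\<^sup>2\<close> and the
  nullity is the number of indices with \<open>d i = 0\<close> (\<open>symmetric_matrix_spectrum\<close>). Cauchy-Schwarz applied
  to all nonzero eigenvalues would bound the energy by \<open>sqrt ((n - null R) * tr R\<^sup>2)\<close>. The bound
  improves when eigenvalues of absolute value 1 are known: they are put aside, they contribute
  exactly 1 each to the energy, and only the others enter Cauchy-Schwarz
  (\<open>sum_abs_le_sqrt_bound\<close>).

  The eigenvalue 1 occurs as soon as there is an edge: the vector of the numbers \<open>sqrt (d\<^sub>u)\<close>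
  is fixed by \<open>R\<close>, because each of the \<open>d\<^sub>u\<close> neighbours \<open>w\<close> of \<open>u\<close> contributes
  \<open>sqrt (d\<^sub>w) / sqrt (d\<^sub>u * d\<^sub>w) = 1 / sqrt (d\<^sub>u)\<close>. In a bipartite graph, changing the sign of this vector
  on one side gives an eigenvector for \<open>-1\<close>
  (both cases are \<open>randic_signed_eigenvector\<close>). In the graph without edges all eigenvalues
  vanish and the bounds are \<open>2\<close> and \<open>4\<close>, since both factors under the root are negative.
\<close>

section \<open>The spectral theorem for real symmetric matrices\<close>

lemma nonneg_quadratic_imp_linear_coeff_zero:
  fixes a q :: real
  assumes "\<And>t. a * t + q * t\<^sup>2 \<ge> 0" and "q \<ge> 0"
  shows "a = 0"
proof -
  \<comment> \<open>The value at \<open>t = -r\<close> is \<open>-r\<^sup>2\<close>; dividing by \<open>q + 1\<close> instead of \<open>q\<close> covers \<open>q = 0\<close>.\<close>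
  define r where "r = a / (q + 1)"
  have a: "a = r * (q + 1)"
    using assms(2) by (simp add: r_def)
  have "a * (- r) + q * (- r)\<^sup>2 = - r\<^sup>2"
    by (simp add: a power2_eq_square algebra_simps)
  then have "r\<^sup>2 \<le> 0"
    using assms(1)[of "- r"] by linarith
  then show ?thesis
    by (simp add: a)
qed

text \<open>
  A maximiser \<open>b\<close> of the Rayleigh quotient \<open>x \<bullet> f x\<close> on the unit sphere of \<open>S\<close> is an
  eigenvector, by the first-order condition in the direction of the defect \<open>c *\<^sub>R b - f b\<close>.
\<close>

lemma selfadjoint_has_eigenvector:
  fixes f :: "'a::euclidean_space \<Rightarrow> 'a"
  assumes f: "linear f" and sym: "\<And>x y. f x \<bullet> y = x \<bullet> f y"
    and S: "subspace S" and inv: "f ` S \<subseteq> S" and "S \<noteq> {0}"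
  obtains b c where "b \<in> S" "norm b = 1" "f b = c *\<^sub>R b"
proof -
  obtain x where x: "x \<in> S" "x \<noteq> 0"
    using S \<open>S \<noteq> {0}\<close> subspace_0 by blast
  have "(1 / norm x) *\<^sub>R x \<in> sphere 0 1 \<inter> S"
    using x S by (simp add: subspace_scale)
  moreover have "compact (sphere 0 1 \<inter> S)"
    by (intro compact_Int_closed closed_subspace S) simp
  moreover have "continuous_on (sphere 0 1 \<inter> S) (\<lambda>x. x \<bullet> f x)"
    by (intro continuous_intros linear_continuous_on linear_conv_bounded_linear[THEN iffD1] f)
  ultimately have "\<exists>b\<in>sphere 0 1 \<inter> S. \<forall>y\<in>sphere 0 1 \<inter> S. y \<bullet> f y \<le> b \<bullet> f b"
    by (intro continuous_attains_sup) blast+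
  then obtain b where b: "b \<in> S" "norm b = 1"
    and max: "\<And>y. y \<in> S \<Longrightarrow> norm y = 1 \<Longrightarrow> y \<bullet> f y \<le> b \<bullet> f b"
    by auto
  define c where "c = b \<bullet> f b"
  define q where "q z = c * (z \<bullet> z) - z \<bullet> f z" for z
  have q_nonneg: "q z \<ge> 0" if "z \<in> S" for z
  proof (cases "z = 0")
    case False
    let ?u = "(1 / norm z) *\<^sub>R z"
    have "?u \<bullet> f ?u \<le> c"
      unfolding c_def using that False S by (intro max) (simp_all add: subspace_scale)
    moreover have "?u \<bullet> f ?u = (z \<bullet> f z) / (z \<bullet> z)"
      using False
      by (simp add: linear_scale[OF f] dot_square_norm power2_eq_square)
    ultimately have "(z \<bullet> f z) / (z \<bullet> z) \<le> c"
      by metis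
    then show ?thesis
      using False by (simp add: q_def pos_divide_le_eq)
  qed (simp add: q_def)
  define w where "w = c *\<^sub>R b - f b"
  have w: "w \<in> S"
    using b S inv by (auto simp: w_def intro!: subspace_diff subspace_scale)
  have bb: "b \<bullet> b = 1"
    using b by (simp add: dot_square_norm)
  \<comment> \<open>Since \<open>q\<close> is nonnegative on \<open>S\<close> and vanishes at \<open>b\<close>, its derivative at \<open>b\<close>
    in the direction \<open>w\<close> vanishes; by self-adjointness that derivative is \<open>2 * (w \<bullet> w)\<close>.\<close>
  have "2 * (w \<bullet> w) * t + q w * t\<^sup>2 \<ge> 0" for t
  proof -
    have "f (b + t *\<^sub>R w) = f b + t *\<^sub>R f w"
      by (simp add: linear_add[OF f] linear_scale[OF f])
    moreover have "b \<bullet> f w = f b \<bullet> w"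
      by (rule sym[symmetric])
    moreover have "w \<bullet> f b = f b \<bullet> w" "w \<bullet> b = b \<bullet> w"
      by (rule inner_commute)+
    moreover have "w \<bullet> w = c * (b \<bullet> w) - f b \<bullet> w"
      by (subst w_def) (simp add: inner_diff_left)
    ultimately have "q (b + t *\<^sub>R w) = 2 * (w \<bullet> w) * t + q w * t\<^sup>2"
      by (simp add: q_def inner_add_left inner_add_right bb c_def[symmetric] power2_eq_square)
        (simp add: algebra_simps)
    then show ?thesis
      using q_nonneg[of "b + t *\<^sub>R w"] b w S by (simp add: subspace_add subspace_scale)
  qed
  then have "2 * (w \<bullet> w) = 0"
    using nonneg_quadratic_imp_linear_coeff_zero q_nonneg[OF w] by blast
  then have "f b = c *\<^sub>R b"
    by (simp add: w_def)
  with b show thesis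
    using that by blast
qed

text \<open>
  Induction on the dimension: the orthogonal complement of an eigenvector within \<open>S\<close> is again
  invariant under \<open>f\<close>. The conclusion omits \<open>span B = S\<close>, because orthonormality and the
  cardinality already make \<open>B\<close> a basis.
\<close>

lemma selfadjoint_orthonormal_eigenbasis:
  fixes f :: "'a::euclidean_space \<Rightarrow> 'a"
  assumes f: "linear f" and sym: "\<And>x y. f x \<bullet> y = x \<bullet> f y"
    and "subspace S" and "f ` S \<subseteq> S"
  shows "\<exists>B. finite B \<and> B \<subseteq> S \<and> card B = dim S \<and> pairwise orthogonal B \<and>
             (\<forall>b\<in>B. norm b = 1 \<and> (\<exists>c. f b = c *\<^sub>R b))"
  using assms(3,4)
proof (induction "dim S" arbitrary: S)
  case 0
  then show ?case
    by (intro exI[of _ "{}"]) auto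
next
  case (Suc k)
  have "S \<noteq> {0}"
    using Suc.hyps(2) by auto
  then obtain b c where b: "b \<in> S" "norm b = 1" "f b = c *\<^sub>R b"
    using selfadjoint_has_eigenvector[OF f sym Suc.prems] by blast
  define T where "T = {y \<in> S. \<forall>x\<in>span {b}. orthogonal x y}"
  have T: "T = {y \<in> S. b \<bullet> y = 0}"
    unfolding T_def by (auto simp: span_singleton orthogonal_def)
  have "b \<noteq> 0"
    using b by auto
  then have "dim T + 1 = dim S"
    using dim_subspace_orthogonal_to_vectors[of "span {b}" S] Suc.prems b
    by (simp add: T_def span_minimal dim_insert)
  then have "k = dim T"
    using Suc.hyps by simp
  moreover have "subspace T"
    using Suc.prems unfolding T subspace_def by (auto simp: inner_add)
  moreover have "f ` T \<subseteq> T"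
    using Suc.prems b unfolding T by (auto simp: sym[symmetric])
  ultimately obtain B where B: "finite B" "B \<subseteq> T" "card B = dim T" "pairwise orthogonal B"
    "\<forall>b\<in>B. norm b = 1 \<and> (\<exists>c. f b = c *\<^sub>R b)"
    using Suc.hyps(1) by blast
  have "b \<notin> B"
    using B(2) b by (auto simp: T dot_square_norm)
  then show ?case
    using B b \<open>dim T + 1 = dim S\<close>
    by (intro exI[of _ "insert b B"])
      (auto simp: T pairwise_insert orthogonal_def inner_commute)
qed

lemma symmetric_matrix_diagonalizable:
  fixes A :: "real^'n^'n"
  assumes "transpose A = A"
  obtains P :: "real^'n^'n" and d :: "'n \<Rightarrow> real"
  where "orthogonal_matrix P" "A ** P = P ** (\<chi> i j. if i = j then d i else 0)"
proof -
  have "(A *v x) \<bullet> y = x \<bullet> (A *v y)" for x y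
    by (metis assms dot_lmul_matrix transpose_matrix_vector)
  then obtain B where B: "finite B" "card B = CARD('n)" "pairwise orthogonal B"
    "\<forall>b\<in>B. norm b = 1 \<and> (\<exists>c. A *v b = c *\<^sub>R b)"
    using selfadjoint_orthonormal_eigenbasis[of "(*v) A" UNIV] by auto
  then obtain h where h: "bij_betw h (UNIV :: 'n set) B"
    by (metis finite_class.finite_UNIV finite_same_card_bij)
  then have hB: "h i \<in> B" for i
    by (auto simp: bij_betw_def)
  then have "\<forall>i. \<exists>c. A *v h i = c *\<^sub>R h i"
    using B(4) by blast
  then obtain d where d: "\<And>i. A *v h i = d i *\<^sub>R h i"
    by (auto dest!: choice)
  show thesis
  proof
    have "orthogonal (h i) (h j)" if "i \<noteq> j" for i j
      using that B(3) h hB by (metis UNIV_I bij_betw_def inj_onD pairwiseD)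
    then show "orthogonal_matrix (\<chi> i j. h j $ i)"
      using B(4) hB by (simp add: orthogonal_matrix_orthonormal_columns column_def)
    have "(A ** (\<chi> i j. h j $ i)) $ i $ j = (A *v h j) $ i" for i j
      by (simp add: matrix_matrix_mult_def matrix_vector_mult_def)
    then show "A ** (\<chi> i j. h j $ i) = (\<chi> i j. h j $ i) ** (\<chi> i j. if i = j then d i else 0)"
      by (simp add: vec_eq_iff d matrix_matrix_mult_def if_distrib mult.commute cong: if_cong)
  qed
qed

text \<open>
  Both matrices are lifted to matrices of constant polynomials. There \<open>X - A\<close> and \<open>X - D\<close> are
  intertwined by the lifted \<open>P\<close>, whose determinant is a unit and can be cancelled.
\<close>

lemma charpoly_similar:
  fixes A D P :: "'a::field^'n^'n"
  assumes "A ** P = P ** D" and "invertible P"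
  shows "charpoly A = charpoly D"
proof -
  define C :: "'a^'n^'n \<Rightarrow> 'a poly^'n^'n" where "C M = (\<chi> i j. [:M $ i $ j:])" for M
  define X :: "'a poly^'n^'n" where "X = (\<chi> i j. if i = j then [:0, 1:] else 0)"
  have sum_const: "(\<Sum>i\<in>I. [:g i:]) = [:sum g I:]" for g :: "'n \<Rightarrow> 'a" and I
    by (induction I rule: infinite_finite_induct) auto
  have C_mult: "C M ** C N = C (M ** N)" for M N
    by (simp add: C_def matrix_matrix_mult_def vec_eq_iff sum_const mult.commute)
  have C_one: "C (mat 1) = mat 1"
    by (simp add: C_def mat_def vec_eq_iff)
  have charpoly: "charpoly M = det (X - C M)" for M
    unfolding charpoly_def C_def X_def by (rule arg_cong[of _ _ det]) (simp add: vec_eq_iff)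
  have "X ** C P = C P ** X"
    by (simp add: X_def matrix_matrix_mult_def vec_eq_iff if_distrib if_distribR mult.commute
        cong: if_cong)
  moreover have "(X - C A) ** C P = X ** C P - C A ** C P"
      "C P ** (X - C D) = C P ** X - C P ** C D"
    by (simp_all add: matrix_matrix_mult_def vec_eq_iff left_diff_distrib right_diff_distrib
        sum_subtractf)
  ultimately have "(X - C A) ** C P = C P ** (X - C D)"
    using assms(1) by (simp add: C_mult)
  then have "det (X - C A) * det (C P) = det (C P) * det (X - C D)"
    by (metis det_mul)
  moreover obtain Q where "P ** Q = mat 1"
    using assms(2) by (auto simp: invertible_def)
  then have "det (C P) * det (C Q) = 1"
    by (metis C_mult C_one det_I det_mul)
  then have "det (C P) \<noteq> 0"
    by auto
  ultimately show ?thesis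
    by (simp add: charpoly mult.commute)
qed

lemma proots_charpoly_diagonal:
  fixes d :: "'n::finite \<Rightarrow> 'a::field"
  shows "proots (charpoly (\<chi> i j. if i = j then d i else 0)) = image_mset d (mset_set UNIV)"
proof -
  have "charpoly (\<chi> i j. if i = j then d i else 0) = (\<Prod>i\<in>UNIV. [:- d i, 1:])"
    unfolding charpoly_def by (subst det_diagonal) auto
  also have "proots \<dots> = (\<Sum>i\<in>UNIV. {#d i#})"
    by (subst proots_prod) auto
  also have "\<dots> = image_mset d (mset_set UNIV)"
    by (simp add: sum_unfold_sum_mset)
  finally show ?thesis .
qed

text \<open>
  One family \<open>d\<close>, indexed by the coordinates, describes the eigenvalue multiset, the nullity
  and the trace at once, so that statements about eigenvalues with multiplicity become
  statements about sums over a finite type.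
\<close>

lemma symmetric_matrix_spectrum:
  fixes A :: "real^'n^'n"
  assumes "transpose A = A"
  obtains d :: "'n \<Rightarrow> real" where
    "eigenvalues_mset A = image_mset d (mset_set UNIV)"
    "nullity A = card {i. d i = 0}"
    "trace (A ** A) = (\<Sum>i\<in>UNIV. (d i)\<^sup>2)"
    "\<forall>v c. A *v v = c *\<^sub>R v \<longrightarrow> v \<noteq> 0 \<longrightarrow> c \<in> range d"
proof -
  obtain P :: "real^'n^'n" and d where P: "orthogonal_matrix P"
    and AP: "A ** P = P ** (\<chi> i j. if i = j then d i else 0)"
    using symmetric_matrix_diagonalizable[OF assms] .
  define D :: "real^'n^'n" where "D = (\<chi> i j. if i = j then d i else 0)"
  define Q where "Q = transpose P"
  have PQ: "P ** Q = mat 1" "Q ** P = mat 1"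
    using P by (auto simp: orthogonal_matrix_def Q_def)
  have AP: "A ** P = P ** D"
    using AP by (simp add: D_def)
  have QA: "Q ** A = D ** Q"
    by (metis AP PQ matrix_mul_assoc matrix_mul_lid matrix_mul_rid)
  have D_mult: "(D *v y) $ i = d i * y $ i" for y i
    by (simp add: D_def matrix_vector_mult_def if_distrib if_distribR cong: if_cong)
  have inj: "inj ((*v) Q)"
    by (metis PQ(1) injI matrix_vector_mul_assoc matrix_vector_mul_lid)
  have eigen: "A *v v = c *\<^sub>R v \<longleftrightarrow> (\<forall>i. d i * (Q *v v) $ i = c * (Q *v v) $ i)" for v c
  proof -
    have "A *v v = c *\<^sub>R v \<longleftrightarrow> Q *v (A *v v) = Q *v (c *\<^sub>R v)"
      using inj by (simp add: inj_eq)
    also have "\<dots> \<longleftrightarrow> D *v (Q *v v) = c *\<^sub>R (Q *v v)"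
      by (simp add: matrix_vector_mul_assoc QA matrix_vector_mult_scaleR)
    finally show ?thesis
      by (simp add: vec_eq_iff D_mult)
  qed
  show thesis
  proof
    have "invertible P"
      using PQ by (auto simp: invertible_def)
    then show "eigenvalues_mset A = image_mset d (mset_set UNIV)"
      by (simp add: eigenvalues_mset_def charpoly_similar[OF AP] proots_charpoly_diagonal D_def)
    have "(*v) Q ` {x. A *v x = 0} = {y. \<forall>i. i \<notin> {i. d i = 0} \<longrightarrow> y $ i = 0}"
    proof (intro subset_antisym subsetI)
      fix y assume "y \<in> (*v) Q ` {x. A *v x = 0}"
      then show "y \<in> {y. \<forall>i. i \<notin> {i. d i = 0} \<longrightarrow> y $ i = 0}"
        using eigen[of _ 0] by auto
    next
      fix y :: "real^'n" assume "y \<in> {y. \<forall>i. i \<notin> {i. d i = 0} \<longrightarrow> y $ i = 0}"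
      moreover have y: "y = Q *v (P *v y)"
        by (simp add: matrix_vector_mul_assoc PQ)
      ultimately have "A *v (P *v y) = 0"
        using eigen[of "P *v y" 0] by auto
      with y show "y \<in> (*v) Q ` {x. A *v x = 0}"
        by blast
    qed
    moreover have "dim ((*v) Q ` {x. A *v x = 0}) = dim {x. A *v x = 0}"
      by (intro dim_image_eq matrix_vector_mul_linear inj_on_subset[OF inj] subset_UNIV)
    ultimately have "dim {x. A *v x = 0} = dim {y :: real^'n. \<forall>i. i \<notin> {i. d i = 0} \<longrightarrow> y $ i = 0}"
      by simp
    then show "nullity A = card {i. d i = 0}"
      unfolding nullity_def by (simp only: dim_substandard_cart flip: dim_vec_eq)
    have "(D ** D) $ i $ i = (\<Sum>k\<in>UNIV. if k = i then (d i)\<^sup>2 else 0)" for i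
      unfolding D_def matrix_matrix_mult_def vec_lambda_beta
      by (rule sum.cong) (auto simp: power2_eq_square)
    then have trace_D: "trace (D ** D) = (\<Sum>i\<in>UNIV. (d i)\<^sup>2)"
      by (simp add: trace_def)
    have "A ** A = P ** (D ** D ** Q)"
      by (metis QA PQ(1) matrix_mul_assoc matrix_mul_lid)
    then have "trace (A ** A) = trace ((D ** D ** Q) ** P)"
      by (metis trace_mul_sym)
    also have "\<dots> = trace (D ** D)"
      by (metis PQ(2) matrix_mul_assoc matrix_mul_rid)
    also note trace_D
    finally show "trace (A ** A) = (\<Sum>i\<in>UNIV. (d i)\<^sup>2)" .
    show "\<forall>v c. A *v v = c *\<^sub>R v \<longrightarrow> v \<noteq> 0 \<longrightarrow> c \<in> range d"
    proof (intro allI impI)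
      fix v c assume v: "A *v v = c *\<^sub>R v" "v \<noteq> 0"
      have "Q *v v \<noteq> 0"
        using inj v(2) by (metis inj_eq matrix_vector_mult_0_right)
      then obtain i where "(Q *v v) $ i \<noteq> 0"
        by (auto simp: vec_eq_iff)
      then have "d i = c"
        using v(1) eigen by auto
      then show "c \<in> range d"
        by blast
    qed
  qed
qed

section \<open>Eigenvectors of the Randic matrix\<close>

lemma randic_matrix_symmetric: "transpose (randic_matrix E) = randic_matrix E"
  by (simp add: randic_matrix_def transpose_def vec_eq_iff insert_commute mult.commute)

text \<open>
  The hypothesis makes \<open>s\<close> change by the factor \<open>c\<close> along every edge. It is used with
  \<open>s = 1\<close>, \<open>c = 1\<close>, and for a bipartite graph with \<open>s\<close> equal to \<open>1\<close> on one side and \<open>-1\<close> on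
  the other, \<open>c = -1\<close>. At an isolated vertex both sides of the eigenvector equation are 0.
\<close>

lemma randic_signed_eigenvector:
  fixes E :: "'v::finite set set" and s :: "'v \<Rightarrow> real"
  assumes "\<And>u w. {u, w} \<in> E \<Longrightarrow> s w = c * s u"
  shows "randic_matrix E *v (\<chi> u. s u * sqrt (degree_of E u))
       = c *\<^sub>R (\<chi> u. s u * sqrt (degree_of E u))"
proof (rule vec_eq_iff[THEN iffD2], rule allI)
  fix u
  have pos: "degree_of E w > 0" if "{u, w} \<in> E" for w
    using that unfolding degree_of_def by (subst card_gt_0_iff) (auto simp: insert_commute)
  have "(randic_matrix E *v (\<chi> u. s u * sqrt (degree_of E u))) $ u
      = (\<Sum>w\<in>UNIV. if {u, w} \<in> E then c * s u / sqrt (degree_of E u) else 0)"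
    unfolding randic_matrix_def matrix_vector_mult_def
    using pos by (auto intro!: sum.cong simp: real_sqrt_mult assms)
  also have "\<dots> = degree_of E u * (c * s u / sqrt (degree_of E u))"
    by (simp add: degree_of_def flip: sum.inter_filter)
  also have "\<dots> = c * s u * (degree_of E u / sqrt (degree_of E u))"
    by simp
  also have "\<dots> = c * s u * sqrt (degree_of E u)"
    by (subst real_div_sqrt) auto
  finally show "(randic_matrix E *v (\<chi> u. s u * sqrt (degree_of E u))) $ u
      = (c *\<^sub>R (\<chi> u. s u * sqrt (degree_of E u))) $ u"
    by simp
qed

section \<open>The energy bound\<close>

text \<open>
  Cauchy-Schwarz over the indices that lie outside \<open>T\<close> and have \<open>d i \<noteq> 0\<close>; there are
  \<open>CARD('n) - card T - card {i. d i = 0}\<close> of them since \<open>d\<close> does not vanish on \<open>T\<close>.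
\<close>

lemma sum_abs_le_sqrt_bound:
  fixes d :: "'n::finite \<Rightarrow> real"
  assumes "\<And>i. i \<in> T \<Longrightarrow> \<bar>d i\<bar> = 1"
  shows "(\<Sum>i\<in>UNIV. \<bar>d i\<bar>)
       \<le> sqrt ((real CARD('n) - card T - card {i. d i = 0}) * ((\<Sum>i\<in>UNIV. (d i)\<^sup>2) - card T))
          + card T"
proof -
  define S where "S = {i. d i \<noteq> 0} - T"
  define Z where "Z = {i. d i = 0}"
  have "UNIV = S \<union> T \<union> Z" "S \<inter> T = {}" "(S \<union> T) \<inter> Z = {}"
    using assms by (force simp: S_def Z_def)+
  then have split: "sum g UNIV = sum g S + sum g T + sum g Z" for g :: "'n \<Rightarrow> real"
    by (metis finite sum.union_disjoint)
  have "real (card S) = real CARD('n) - card T - card Z"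
    using split[of "\<lambda>_. 1"] by simp
  moreover have "(d i)\<^sup>2 = 1" if "i \<in> T" for i
    using assms[OF that] by (metis one_power2 power2_abs)
  then have "(\<Sum>i\<in>S. (d i)\<^sup>2) = (\<Sum>i\<in>UNIV. (d i)\<^sup>2) - card T"
    by (simp add: split Z_def)
  moreover have "(\<Sum>i\<in>UNIV. \<bar>d i\<bar>) = (\<Sum>i\<in>S. \<bar>d i\<bar>) + card T"
    using assms by (simp add: split Z_def)
  moreover have "(\<Sum>i\<in>S. \<bar>d i\<bar>) \<le> sqrt (card S * (\<Sum>i\<in>S. (d i)\<^sup>2))"
    using Cauchy_Schwarz_ineq_sum[of "\<lambda>_. 1" "\<lambda>i. \<bar>d i\<bar>" S] by (simp add: real_le_rsqrt)
  ultimately show ?thesis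
    by (simp add: Z_def)
qed

theorem corollary3p4:
  fixes E :: "'v::finite set set" and R :: "real^'v^'v" and n :: nat
  assumes "simple_graph E"
    and "n = CARD('v)"
    and "R = randic_matrix E"
  shows "randic_energy E
           \<le> sqrt ((real n - 1 - real (nullity R)) * (trace (R ** R) - 1)) + 1
         \<and> (bipartite E \<longrightarrow>
             randic_energy E
               \<le> sqrt ((real n - 2 - real (nullity R)) * (trace (R ** R) - 2)) + 2)"
proof -
  have sym: "transpose R = R"
    by (simp add: assms(3) randic_matrix_symmetric)
  obtain d :: "'v \<Rightarrow> real" where mset: "eigenvalues_mset R = image_mset d (mset_set UNIV)"
    and null: "nullity R = card {i. d i = 0}"
    and tr: "trace (R ** R) = (\<Sum>i\<in>UNIV. (d i)\<^sup>2)"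
    and eigen: "\<forall>v c. R *v v = c *\<^sub>R v \<longrightarrow> v \<noteq> 0 \<longrightarrow> c \<in> range d"
    using symmetric_matrix_spectrum[OF sym] by blast
  have energy: "randic_energy E = (\<Sum>i\<in>UNIV. \<bar>d i\<bar>)"
    using mset assms(3)
    by (simp add: randic_energy_def sum_unfold_sum_mset image_mset.compositionality comp_def)
  have bound: "randic_energy E \<le> sqrt ((real n - card T - real (nullity R))
      * (trace (R ** R) - card T)) + card T" if "\<And>i. i \<in> T \<Longrightarrow> \<bar>d i\<bar> = 1" for T
    using sum_abs_le_sqrt_bound[of T d] that by (simp add: energy null tr assms(2))
  show ?thesis
  proof (cases "E = {}")
    case True
    \<comment> \<open>Here \<open>1\<close> is not an eigenvalue, so there is no index to put aside; but
      \<open>nullity R = n\<close> and the trace is \<open>0\<close>, so the factors under the roots are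
      \<open>-1, -1\<close> and \<open>-2, -2\<close>.\<close>
    then have "R = 0"
      by (simp add: assms(3) randic_matrix_def vec_eq_iff)
    then have "trace (R ** R) = 0"
      by (simp add: trace_def)
    then have "d i = 0" for i
      using tr by (simp add: sum_nonneg_eq_0_iff)
    then show ?thesis
      using tr by (simp add: energy null assms(2))
  next
    case False
    then obtain e where "e \<in> E"
      by blast
    then obtain u v where uv: "{u, v} \<in> E"
      using assms(1) by (auto simp: simple_graph_def card_2_iff)
    then have deg: "degree_of E u > 0"
      unfolding degree_of_def by (subst card_gt_0_iff) auto
    have signed_eigenvalue: "c \<in> range d"
      if "\<And>u w. {u, w} \<in> E \<Longrightarrow> s w = c * s u" "s u \<noteq> 0" for s c
    proof (rule eigen[rule_format])
      show "R *v (\<chi> u. s u * sqrt (degree_of E u)) = c *\<^sub>R (\<chi> u. s u * sqrt (degree_of E u))"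
        unfolding assms(3) using that(1) by (rule randic_signed_eigenvector)
      show "(\<chi> u. s u * sqrt (degree_of E u)) \<noteq> 0"
        using deg that(2) by (auto simp: vec_eq_iff)
    qed
    have "1 \<in> range d"
      by (rule signed_eigenvalue[of "\<lambda>_. 1"]) simp_all
    then obtain i where i: "d i = 1"
      by auto
    have "randic_energy E
        \<le> sqrt ((real n - 2 - real (nullity R)) * (trace (R ** R) - 2)) + 2" if bip: "bipartite E"
    proof -
      obtain X Y where XY: "X \<union> Y = UNIV" "X \<inter> Y = {}" "\<forall>e\<in>E. \<exists>x\<in>X. \<exists>y\<in>Y. e = {x, y}"
        using bip unfolding bipartite_def by (elim exE conjE)
      define s :: "'v \<Rightarrow> real" where "s u = (if u \<in> X then 1 else -1)" for u
      have "s w = -1 * s u" if "{u, w} \<in> E" for u w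
      proof -
        obtain x y where "x \<in> X" "y \<in> Y" "{u, w} = {x, y}"
          using XY(3) \<open>{u, w} \<in> E\<close> by blast
        then show ?thesis
          using XY(2) by (auto simp: s_def doubleton_eq_iff)
      qed
      moreover have "s u \<noteq> 0"
        by (simp add: s_def)
      ultimately have "-1 \<in> range d"
        by (rule signed_eigenvalue)
      then obtain j where j: "d j = -1"
        by fastforce
      have "i \<noteq> j"
        using i j by auto
      have "\<bar>d k\<bar> = 1" if "k \<in> {i, j}" for k
        using that i j by auto
      from bound[of "{i, j}", OF this] \<open>i \<noteq> j\<close> show ?thesis
        by simp
    qed
    then show ?thesis
      using bound[of "{i}"] i by auto
  qed
qed

end
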